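(* Fix $a_1,\dots,a_{d-1}\in\mathbb{Z}_{\ge 1}$ and let $M := \mathrm{lcm}\left(a_1,\dots,a_{d-1},\,-1+\sum_{i=1}^{d-1}a_i\right)$. Let $S_N\subset\mathbb{R}^d$ denote the one-row Hermite normal form simplex with non-trivial row $(a_1,\dots,a_{d-1},N)$, which has normalized volume $N$, and let $B(S_N;z)$ be its local $h^*$-polynomial. Let $k$ be a positive integer and $r$ an integer with $0\le r\le M-1$. Then $$\lim_{k\to\infty}\frac{B(S_{kM+r};z)}{B(S_{kM+r};1)}=\frac{B(S_{M+1};z)}{B(S_{M+1};1)}.$$ It follows that if $B(S_{M+1};z)$ is strictly unimodal, i.e., if the coefficients are unimodal with strict increases and strict decreases, then $B(S_{kM+r};z)$ is strictly unimodal for all sufficiently large $k$.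
   Context: The simplex with non-trivial row $(a_1,\dots,a_{d-1},N)$ (normalized volume $N$) is the convex hull in $\mathbb{R}^d$ of $0,e_1,\dots,e_{d-1}$ and $(a_1,\dots,a_{d-1},N)$, where $e_i$ are standard basis vectors. Let $A$ be the $(d+1)\times(d+1)$ matrix whose rows are these vertices (in this order) with an initial coordinate $1$ prepended. Put $\Lambda=\mathbb{Z}^{d+1}A^{-1}$ and $\Gamma=\Lambda/\mathbb{Z}^{d+1}$. Explicitly, the elements of $\Gamma$ are the classes of $$\ell\left(\tfrac{-1+\sum_{i=1}^{d-1} a_i}{N},-\tfrac{a_1}{N},\dots,-\tfrac{a_{d-1}}{N},\tfrac1N\right),\qquad 0\le \ell\le N-1.$$ For $x=(x_0,\dots,x_d)\in\Lambda$ let $\mathrm{age}(x)=\sum_{i=0}^d\{x_i\}$, where $\{t\}=t-\lfloor t\rfloor$; this depends only on the class of $x$ in $\Gamma$. The local $h^*$-polynomial is $$B(S_N;z)=\sum_{i=1}^d b_iz^i=\sum_{x} z^{\mathrm{age}(x)},$$ the sum over those $x\in\Gamma$ whose representative in $[0,1)^{d+1}$ lies in $(0,1)^{d+1}$ (i.e. no coordinate is an integer). *)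

theory Defs
  imports
    Complex_Main
    "HOL-Computational_Algebra.Polynomial"
    "Jordan_Normal_Form.Gauss_Jordan_Elimination"
begin

text \<open>
  A \<open>d\<close>-dimensional lattice simplex is given by the list of its \<open>d + 1\<close> vertices. The coefficients
  \<open>a\<^sub>1, \<dots>, a\<^sub>d\<^sub>-\<^sub>1\<close> are the values of \<open>a\<close> at \<open>1, \<dots>, d - 1\<close>; vector entries are indexed from 0.
\<close>

definition one_row_simplex :: "nat \<Rightarrow> (nat \<Rightarrow> int) \<Rightarrow> int \<Rightarrow> real vec list" where
  "one_row_simplex d a N =
     0\<^sub>v d # map (unit_vec d) [0..<d - 1] @
     [vec d (\<lambda>j. of_int (if j < d - 1 then a (j + 1) else N))]"

definition vertex_matrix :: "real vec list \<Rightarrow> real mat" where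
  "vertex_matrix vs = mat_of_rows (length vs) (map (vCons 1) vs)"

definition int_vecs :: "nat \<Rightarrow> real vec set" where
  "int_vecs n = {u \<in> carrier_vec n. \<forall>i<n. u $ i \<in> \<int>}"

text \<open>
  \<open>\<Lambda> = \<int>\<^sup>n A\<^sup>-\<^sup>1\<close> with \<open>n = d + 1\<close>. Integer vectors act on \<open>A\<^sup>-\<^sup>1\<close> as rows from the left, hence the
  transpose. For a singular \<open>A\<close> (never the case for a simplex) the value is unspecified.
\<close>

definition simplex_lattice :: "real vec list \<Rightarrow> real vec set" where
  "simplex_lattice vs =
     (\<lambda>u. transpose_mat (the (mat_inverse (vertex_matrix vs))) *\<^sub>v u) ` int_vecs (length vs)"

definition simplex_group :: "real vec list \<Rightarrow> real vec set set" where
  "simplex_group vs = (\<lambda>x. (\<lambda>u. x + u) ` int_vecs (length vs)) ` simplex_lattice vs"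

definition class_rep :: "real vec set \<Rightarrow> real vec" where
  "class_rep C = (THE x. x \<in> C \<and> (\<forall>i<dim_vec x. 0 \<le> x $ i \<and> x $ i < 1))"

definition age :: "real vec \<Rightarrow> real" where
  "age x = (\<Sum>i<dim_vec x. frac (x $ i))"

text \<open>
  On the lattice of a simplex the age is a natural number, because the first column of the vertex
  matrix consists of ones; the conversion \<open>nat \<lfloor>\<dots>\<rfloor>\<close> below therefore loses nothing.
\<close>

definition local_hstar :: "real vec list \<Rightarrow> real poly" where
  "local_hstar vs =
     (\<Sum>C \<in> {C \<in> simplex_group vs. \<forall>i<length vs. 0 < class_rep C $ i \<and> class_rep C $ i < 1}.
        monom 1 (nat \<lfloor>age (class_rep C)\<rfloor>))"

text \<open>
  Strict unimodality of the coefficients \<open>b\<^sub>1, \<dots>, b\<^sub>d\<close>: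
  \<open>b\<^sub>1 < \<dots> < b\<^sub>m \<ge> b\<^sub>m\<^sub>+\<^sub>1 > \<dots> > b\<^sub>d\<close>. Two equal coefficients are admitted at the peak, since
  local \<open>h\<^sup>*\<close>-polynomials satisfy \<open>b\<^sub>i = b\<^sub>d\<^sub>+\<^sub>1\<^sub>-\<^sub>i\<close> and so \<open>b\<^sub>d\<^sub>/\<^sub>2 = b\<^sub>d\<^sub>/\<^sub>2\<^sub>+\<^sub>1\<close> for even \<open>d\<close>.
  For odd \<open>d\<close> this symmetry forces \<open>b\<^sub>m > b\<^sub>m\<^sub>+\<^sub>1\<close>.
\<close>

definition strictly_unimodal :: "nat \<Rightarrow> real poly \<Rightarrow> bool" where
  "strictly_unimodal d p \<longleftrightarrow>
     (\<exists>m\<in>{1..d}.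
        (\<forall>i. 1 \<le> i \<and> i < m \<longrightarrow> coeff p i < coeff p (i + 1)) \<and>
        (m < d \<longrightarrow> coeff p m \<ge> coeff p (m + 1)) \<and>
        (\<forall>i. m < i \<and> i < d \<longrightarrow> coeff p i > coeff p (i + 1)))"

end

theory Submission
  imports Defs "Jordan_Normal_Form.Determinant"
begin

text \<open>
  Up to integers, the coordinates of the lattice points of \<open>S\<^sub>N\<close> are \<open>c\<^sub>i t\<close> with \<open>t = l / N\<close>, where the
  integers \<open>c\<^sub>i\<close> do not depend on \<open>N\<close>, sum to zero and divide \<open>M\<close>. Hence the age of such a point is
  \<open>- (\<Sum>i. \<lfloor>c\<^sub>i t\<rfloor>)\<close>, which is constant for \<open>t\<close> in an open cell \<open>((j - 1) / M, j / M)\<close>, and no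
  coordinate is an integer there. Each of the \<open>M\<close> cells contains \<open>N / M + O(1)\<close> of the points \<open>l / N\<close>,
  at most \<open>M\<close> of these points lie on the boundaries of the cells, and for \<open>N = M + 1\<close> every cell
  contains exactly one of them. This gives the limit. Strict inequalities between coefficients pass from the limit to
  all large \<open>k\<close>; two equal coefficients at the peak must be the two middle ones, and these agree for
  every \<open>N\<close> because \<open>t \<mapsto> 1 - t\<close> replaces the age by \<open>d + 1\<close> minus the age.
\<close>

section \<open>Ages of the points with coordinates proportional to fixed weights\<close>

text \<open>With \<open>M = c * m\<close>, the product \<open>c * t\<close> is
  \<open>M * t / m\<close> and stays strictly between \<open>j / m\<close> and
  \<open>(j + 1) / m\<close>. An integer there, multiplied by \<open>m\<close>, would lie strictly
  between \<open>j\<close> and \<open>j + 1\<close>.\<close>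

lemma strict_floor_cell:
  fixes c j M :: int
  assumes "c dvd M" "M > 0"
  shows "\<exists>q::int. \<forall>t::real. j < M * t \<and> M * t < j + 1 \<longrightarrow> q < c * t \<and> c * t < q + 1"
proof -
  from \<open>c dvd M\<close> obtain m where m: "M = c * m" ..
  show ?thesis
  proof (cases "c > 0")
    case True
    then have "m > 0" using m \<open>M > 0\<close> by (simp add: zero_less_mult_iff)
    define q where "q = j div m"
    have "q * m = j - j mod m"
      unfolding q_def by (rule minus_mod_eq_div_mult[symmetric])
    then have lo: "q * m \<le> j" and hi: "j + 1 \<le> (q + 1) * m"
      using pos_mod_bound[OF \<open>m > 0\<close>, of j] pos_mod_sign[OF \<open>m > 0\<close>, of j]
      unfolding distrib_right by linarith+
    show ?thesis
    proof (intro exI[of _ q] allI impI)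
      fix t :: real
      assume "j < M * t \<and> M * t < j + 1"
      moreover have "real_of_int (q * m) \<le> real_of_int j"
        "real_of_int (j + 1) \<le> real_of_int ((q + 1) * m)"
        using lo hi by (simp_all only: of_int_le_iff)
      ultimately have "real_of_int q * m < (c * t) * m" "(c * t) * m < (real_of_int q + 1) * m"
        by (simp_all add: m mult_ac)
      then show "q < c * t \<and> c * t < q + 1"
        using \<open>m > 0\<close> by (simp add: mult_less_cancel_right)
    qed
  next
    case False
    then have "m < 0" using m \<open>M > 0\<close> by (simp add: zero_less_mult_iff)
    define q where "q = - (j div (- m)) - 1"
    have "(q + 1) * m = j - j mod (- m)"
      using minus_mod_eq_div_mult[of j "- m"] by (simp only: q_def) simp
    then have lo: "(q + 1) * m \<le> j" and hi: "j + 1 \<le> q * m"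
      using \<open>m < 0\<close> pos_mod_bound[of "- m" j] pos_mod_sign[of "- m" j]
      unfolding distrib_right by linarith+
    show ?thesis
    proof (intro exI[of _ q] allI impI)
      fix t :: real
      assume "j < M * t \<and> M * t < j + 1"
      moreover have "real_of_int ((q + 1) * m) \<le> real_of_int j"
        "real_of_int (j + 1) \<le> real_of_int (q * m)"
        using lo hi by (simp_all only: of_int_le_iff)
      ultimately have "(real_of_int q + 1) * m < (c * t) * m" "(c * t) * m < real_of_int q * m"
        by (simp_all add: m mult_ac)
      then show "q < c * t \<and> c * t < q + 1"
        using \<open>m < 0\<close> by (simp add: mult_less_cancel_right)
    qed
  qed
qed

lemma not_Ints_between:
  fixes x :: real and q :: int
  assumes "q < x" "x < q + 1"
  shows "x \<notin> \<int>"
  using assms by (auto elim!: Ints_cases)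

lemma card_int_open_interval:
  fixes x y :: real
  assumes "x \<le> y"
  shows "\<bar>real (card {l::int. x < l \<and> l < y}) - (y - x)\<bar> \<le> 1"
proof -
  have "{l::int. x < l \<and> l < y} = {\<lfloor>x\<rfloor> + 1..\<lceil>y\<rceil> - 1}"
    by (auto simp: less_ceiling_iff floor_less_iff) (linarith+)
  then have "card {l::int. x < l \<and> l < y} = nat (\<lceil>y\<rceil> - 1 - \<lfloor>x\<rfloor>)"
    by simp
  \<comment> \<open>\<open>nat\<close> truncates only when \<open>x = y\<close> is an integer: the
    count is then \<open>0\<close> while the difference is \<open>- 1\<close>.\<close>
  moreover have "real (nat (\<lceil>y\<rceil> - 1 - \<lfloor>x\<rfloor>)) = max 0 (\<lceil>y\<rceil> - 1 - \<lfloor>x\<rfloor>)"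
    by (simp add: of_nat_nat max_def)
  ultimately show ?thesis
    using assms by linarith
qed

text \<open>The counting rests on these properties alone; the simplex merely supplies the weights.
  As \<open>M\<close> is positive, \<open>weight_dvd\<close> forces every weight to be
  nonzero.\<close>

locale zero_sum_weights =
  fixes d :: nat and c :: "nat \<Rightarrow> int" and M :: int
  assumes sum_weights: "(\<Sum>i\<le>d. c i) = 0"
    and M_pos: "M > 0"
    and weight_dvd: "\<And>i. i \<le> d \<Longrightarrow> c i dvd M"
begin

definition nonint_points :: "int \<Rightarrow> int set" where
  "nonint_points N = {l\<in>{0..<N}. \<forall>i\<le>d. c i * (l / N) \<notin> (\<int> :: real set)}"

text \<open>An integer form of the age: in the sum of the fractional parts of \<open>c i * t\<close>
  the linear terms cancel.\<close>

definition int_age :: "real \<Rightarrow> int" where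
  "int_age t = - (\<Sum>i\<le>d. \<lfloor>of_int (c i) * t\<rfloor>)"

text \<open>A predicate lets one count serve both a single coefficient (\<open>Q\<close> fixes the
  age) and the value at 1 (\<open>Q\<close> is always true).\<close>

definition points_with_age :: "(int \<Rightarrow> bool) \<Rightarrow> int \<Rightarrow> int set" where
  "points_with_age Q N = {l \<in> nonint_points N. Q (int_age (l / N))}"

lemma finite_nonint_points [simp]: "finite (nonint_points N)"
  by (rule finite_subset[of _ "{0..<N}"]) (auto simp: nonint_points_def)

lemma finite_points_with_age [simp]: "finite (points_with_age Q N)"
  by (simp add: points_with_age_def)

lemma sum_frac_eq_int_age:
  fixes t :: real
  shows "(\<Sum>i\<le>d. frac (c i * t)) = int_age t"
proof -
  have "(\<Sum>i\<le>d. frac (c i * t)) = (\<Sum>i\<le>d. real_of_int (c i)) * t - (\<Sum>i\<le>d. \<lfloor>c i * t\<rfloor>)"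
    by (simp add: frac_def sum_subtractf sum_distrib_right)
  also have "(\<Sum>i\<le>d. real_of_int (c i)) = 0"
    using sum_weights by (metis of_int_0 of_int_sum)
  finally show ?thesis
    by (simp add: int_age_def)
qed

lemma int_age_nonneg: "int_age t \<ge> 0"
proof -
  have "(\<Sum>i\<le>d. frac (c i * t)) \<ge> 0"
    by (intro sum_nonneg) simp
  then show ?thesis
    by (simp add: sum_frac_eq_int_age)
qed

section \<open>Reflection symmetry of the ages\<close>

text \<open>For a noninteger \<open>x\<close>, the floor of \<open>- x\<close> is \<open>- 1\<close>
  minus the floor of \<open>x\<close>. Each of the \<open>d + 1\<close> indices contributes one such
  \<open>- 1\<close>, and the weights add up to zero.\<close>

lemma int_age_reflect:
  fixes t :: real
  assumes "\<And>i. i \<le> d \<Longrightarrow> c i * t \<notin> \<int>"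
  shows "int_age (1 - t) = int d + 1 - int_age t"
proof -
  have "\<lfloor>c i * (1 - t)\<rfloor> = c i - 1 - \<lfloor>c i * t\<rfloor>" if "i \<le> d" for i
  proof -
    have "\<lceil>c i * t\<rceil> = \<lfloor>c i * t\<rfloor> + 1"
      using assms[OF that] by (simp add: ceiling_altdef) (metis Ints_of_int)
    moreover have "\<lfloor>c i * (1 - t)\<rfloor> = c i + \<lfloor>- (c i * t)\<rfloor>"
      by (metis add.commute diff_conv_add_uminus floor_add_int mult.right_neutral right_diff_distrib)
    ultimately show ?thesis
      by (simp add: ceiling_def)
  qed
  then have "(\<Sum>i\<le>d. \<lfloor>c i * (1 - t)\<rfloor>) = (\<Sum>i\<le>d. c i - 1 - \<lfloor>c i * t\<rfloor>)"
    by (intro sum.cong) auto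
  also have "\<dots> = - (int d + 1) - (\<Sum>i\<le>d. \<lfloor>c i * t\<rfloor>)"
    by (simp add: sum_subtractf sum_weights)
  finally show ?thesis
    by (simp add: int_age_def)
qed

text \<open>The involution sending \<open>l\<close> to \<open>N - l\<close> keeps all coordinates
  nonintegral and exchanges the ages \<open>j\<close> and \<open>d + 1 - j\<close>.\<close>

lemma card_points_with_age_symmetric:
  assumes "N > 0"
  shows "card (points_with_age (\<lambda>n. n = int d + 1 - j) N) = card (points_with_age (\<lambda>n. n = j) N)"
proof -
  have refl: "N - l \<in> points_with_age (\<lambda>n. n = int d + 1 - j) N"
    if l: "l \<in> points_with_age (\<lambda>n. n = j) N" for l j
  proof -
    have ni: "c i * (l / N) \<notin> (\<int>::real set)" if "i \<le> d" for i
      using l that by (simp add: points_with_age_def nonint_points_def)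
    \<comment> \<open>At \<open>0\<close> all coordinates are integers; excluding it keeps
      \<open>N - l\<close> below \<open>N\<close>.\<close>
    have "l \<noteq> 0"
      using ni[of 0] by auto
    then have "N - l \<in> {0..<N}"
      using l by (auto simp: points_with_age_def nonint_points_def)
    moreover have eq: "(real_of_int N - l) / N = 1 - l / N"
      using \<open>N > 0\<close> by (simp add: field_simps)
    moreover have "c i * (1 - l / N) \<notin> (\<int>::real set)" if "i \<le> d" for i
    proof
      assume "c i * (1 - l / N) \<in> (\<int>::real set)"
      then have "c i - c i * (1 - l / N) \<in> (\<int>::real set)"
        by (intro Ints_diff) auto
      moreover have "c i - c i * (1 - l / N) = c i * (l / N :: real)"
        by (simp add: algebra_simps)
      ultimately show False
        using ni[OF that] by metis
    qed
    moreover have "int_age (1 - l / N) = int d + 1 - j"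
      using int_age_reflect[of "l / N"] ni l by (simp add: points_with_age_def)
    ultimately show ?thesis
      unfolding points_with_age_def nonint_points_def of_int_diff mem_Collect_eq eq by blast
  qed
  have "bij_betw (\<lambda>l. N - l) (points_with_age (\<lambda>n. n = int d + 1 - j) N)
          (points_with_age (\<lambda>n. n = j) N)"
    by (rule bij_betwI[where g = "\<lambda>l. N - l"])
      (use refl[of _ j] refl[of _ "int d + 1 - j"] in auto)
  then show ?thesis
    by (rule bij_betw_same_card)
qed

section \<open>Cells of constant age and their sample points\<close>

text \<open>All floors are frozen inside a cell: each \<open>c i * t\<close> stays between the same
  two consecutive integers.\<close>

lemma int_age_cell:
  fixes j :: int and s t :: real
  assumes "j < M * s" "M * s < j + 1" "j < M * t" "M * t < j + 1"
  shows "int_age s = int_age t"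
proof -
  have "\<lfloor>c i * s\<rfloor> = \<lfloor>c i * t\<rfloor>" if i: "i \<le> d" for i
  proof -
    obtain q :: int where q: "\<forall>t::real. j < M * t \<and> M * t < j + 1 \<longrightarrow> q < c i * t \<and> c i * t < q + 1"
      using strict_floor_cell[OF weight_dvd[OF i] M_pos, of j] by blast
    have "\<lfloor>c i * s\<rfloor> = q" "\<lfloor>c i * t\<rfloor> = q"
      using q assms by (auto simp: floor_eq_iff)
    then show ?thesis by simp
  qed
  then show ?thesis
    unfolding int_age_def by (auto intro: sum.cong)
qed

lemma nonint_cell:
  fixes j :: int and t :: real
  assumes "j < M * t" "M * t < j + 1" "i \<le> d"
  shows "c i * t \<notin> \<int>"
proof -
  obtain q :: int where "q < c i * t" "c i * t < q + 1"
    using strict_floor_cell[OF weight_dvd[OF \<open>i \<le> d\<close>] M_pos, of j] assms by blast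
  then show ?thesis
    by (rule not_Ints_between)
qed

text \<open>\<open>M * l / (M + 1)\<close> equals \<open>l - l / (M + 1)\<close>, and the subtracted
  fraction lies strictly between 0 and 1.\<close>

lemma sample_point_in_cell:
  fixes l :: int
  assumes "1 \<le> l" "l \<le> M"
  shows "real_of_int (l - 1) < M * (l / (M + 1))" "M * (l / (M + 1)) < real_of_int l"
proof -
  have "real_of_int (M + 1) * (l - 1) < M * l"
    using assms unfolding of_int_mult[symmetric] of_int_less_iff by (simp add: algebra_simps)
  then show "real_of_int (l - 1) < M * (l / (M + 1))"
    using M_pos by (simp add: field_simps)
  show "M * (l / (M + 1)) < real_of_int l"
    using M_pos assms by (simp add: field_simps)
qed

text \<open>Numerator \<open>0\<close> gives integer coordinates, and every other one gives a point
  inside a cell. Counting for \<open>N = M + 1\<close> is therefore counting cells.\<close>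

lemma nonint_points_Suc: "nonint_points (M + 1) = {1..M}"
proof
  show "nonint_points (M + 1) \<subseteq> {1..M}"
  proof
    fix l assume l: "l \<in> nonint_points (M + 1)"
    then have "l \<noteq> 0"
      by (auto simp: nonint_points_def)
    then show "l \<in> {1..M}"
      using l by (auto simp: nonint_points_def)
  qed
  show "{1..M} \<subseteq> nonint_points (M + 1)"
  proof
    fix l assume "l \<in> {1..M}"
    then show "l \<in> nonint_points (M + 1)"
      using nonint_cell[of "l - 1" "l / (M + 1)"] sample_point_in_cell[of l]
      by (simp add: nonint_points_def)
  qed
qed

section \<open>Counting points cell by cell\<close>

text \<open>The count for \<open>M + 1\<close> is the number of cells whose age satisfies
  \<open>Q\<close>. Each of these at most \<open>M\<close> cells holds \<open>N / M\<close> points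
  up to an error of 1, and the boundary points add at most another \<open>M\<close>.\<close>

lemma card_points_with_age_approx:
  fixes N :: int
  assumes "N > 0"
  shows "\<bar>real (card (points_with_age Q N)) - card (points_with_age Q (M + 1)) * (N / M)\<bar> \<le> 2 * M"
proof -
  \<comment> \<open>\<open>j\<close> names the cell \<open>((j - 1) / M, j / M)\<close>, represented by its sample point \<open>j / (M + 1)\<close>. The
    set \<open>I j\<close> collects the \<open>l\<close> with \<open>l / N\<close> in that cell, and \<open>E\<close> those on cell boundaries.\<close>
  define J where "J = points_with_age Q (M + 1)"
  define I where "I j = {l::int. (j - 1) * (N / M) < real_of_int l \<and> real_of_int l < j * (N / M)}" for j :: int
  define E where "E = {l \<in> points_with_age Q N. N dvd M * l}"
  \<comment> \<open>Serves twice: to locate the cell of \<open>l\<close>, and to bound the number of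
    boundary points.\<close>
  have cell_index: "0 \<le> M * l div N \<and> M * l div N < M" if "0 \<le> l" "l < N" for l
  proof -
    have "(M * l div N) * N \<le> M * l"
      using minus_mod_eq_div_mult[of "M * l" N] pos_mod_sign[OF \<open>N > 0\<close>, of "M * l"] by linarith
    also have "M * l < M * N"
      using M_pos that by simp
    finally show ?thesis
      using M_pos \<open>N > 0\<close> that by (simp add: pos_imp_zdiv_nonneg_iff mult_less_cancel_right)
  qed
  have J_sub: "J \<subseteq> {1..M}"
    unfolding J_def points_with_age_def nonint_points_Suc by blast
  have "card J \<le> card {1..M}"
    by (rule card_mono) (use J_sub in simp_all)
  then have J_card: "card J \<le> M"
    using M_pos by simp
  have I_iff: "l \<in> I j \<longleftrightarrow> (j - 1) < M * (l / N :: real) \<and> M * (l / N :: real) < j" for l j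
    using M_pos \<open>N > 0\<close> by (simp add: I_def field_simps)
  have I_int: "l \<in> I j \<longleftrightarrow> (j - 1) * N < M * l \<and> M * l < j * N" for l j
  proof -
    have "l \<in> I j \<longleftrightarrow> real_of_int ((j - 1) * N) < M * l \<and> M * l < real_of_int (j * N)"
      using M_pos \<open>N > 0\<close> by (simp add: I_def field_simps)
    then show ?thesis
      by (metis of_int_less_iff of_int_mult)
  qed
  have fin_I: "finite (I j)" for j
  proof (rule finite_subset)
    show "I j \<subseteq> {\<lfloor>(j - 1) * (N / M)\<rfloor>..\<lceil>j * (N / M)\<rceil>}"
      by (auto simp: I_def) linarith+
  qed auto
  have I_card: "\<bar>real (card (I j)) - N / M\<bar> \<le> 1" for j
  proof -
    have "(j - 1) * (N / M) \<le> j * (N / M :: real)"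
      using M_pos \<open>N > 0\<close> by (simp add: field_simps)
    moreover have "j * (N / M) - (j - 1) * (N / M) = (N / M :: real)"
      by (simp add: left_diff_distrib diff_divide_distrib)
    ultimately show ?thesis
      using card_int_open_interval[of "(j - 1) * (N / M)" "j * (N / M)"] unfolding I_def by simp
  qed
  have I_disj: "I j \<inter> I j' = {}" if "j \<noteq> j'" for j j'
  proof -
    have "False" if "l \<in> I j" "l \<in> I j'" for l
    proof -
      have "real_of_int (j - 1) < j'" "real_of_int (j' - 1) < j"
        using that by (auto simp: I_iff)
      then show False using \<open>j \<noteq> j'\<close> by linarith
    qed
    then show ?thesis by blast
  qed
  \<comment> \<open>On a boundary \<open>M * l\<close> is a multiple of \<open>N\<close>; inside a
    cell it lies strictly between consecutive multiples.\<close>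
  have E_disj: "E \<inter> (\<Union>j\<in>J. I j) = {}"
  proof -
    have False if "l \<in> E" "l \<in> I j" for l j
    proof -
      from \<open>l \<in> E\<close> obtain q where "M * l = N * q"
        by (auto simp: E_def)
      then have "(j - 1) * N < q * N" "q * N < j * N"
        using \<open>l \<in> I j\<close> by (auto simp: I_int mult_ac)
      then show False
        using \<open>N > 0\<close> by (simp add: mult_less_cancel_right)
    qed
    then show ?thesis by blast
  qed
  have dec: "points_with_age Q N = E \<union> (\<Union>j\<in>J. I j)"
  proof (intro equalityI subsetI)
    fix l assume l: "l \<in> points_with_age Q N"
    show "l \<in> E \<union> (\<Union>j\<in>J. I j)"
    proof (cases "N dvd M * l")
      case False
      \<comment> \<open>Cells are named by their upper end, hence the \<open>+ 1\<close>.
        Nondivisibility then makes the lower bound strict.\<close>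
      define j where "j = M * l div N + 1"
      have l0: "0 \<le> l" "l < N"
        using l by (auto simp: points_with_age_def nonint_points_def)
      have "M * l mod N \<noteq> 0"
        using False by (simp add: dvd_eq_mod_eq_0)
      moreover have "(j - 1) * N = M * l - M * l mod N"
        unfolding j_def add_diff_cancel_right' by (rule minus_mod_eq_div_mult[symmetric])
      moreover have "j * N = (j - 1) * N + N"
        by (simp add: left_diff_distrib)
      ultimately have "(j - 1) * N < M * l" "M * l < j * N"
        using pos_mod_bound[OF \<open>N > 0\<close>, of "M * l"] pos_mod_sign[OF \<open>N > 0\<close>, of "M * l"]
        by linarith+
      then have "l \<in> I j"
        by (simp add: I_int)
      have "0 \<le> M * l div N" "M * l div N < M"
        using cell_index[OF l0] by auto
      then have j: "1 \<le> j" "j \<le> M"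
        by (simp_all add: j_def)
      have "int_age (l / N) = int_age (j / (M + 1))"
        using int_age_cell[of "j - 1" "l / N" "j / (M + 1)"] \<open>l \<in> I j\<close> sample_point_in_cell[OF j]
        by (simp add: I_iff)
      then have "j \<in> J"
        using l j by (simp add: J_def points_with_age_def nonint_points_Suc)
      then show ?thesis
        using \<open>l \<in> I j\<close> by blast
    qed (use l in \<open>simp add: E_def\<close>)
  next
    fix l assume "l \<in> E \<union> (\<Union>j\<in>J. I j)"
    then consider "l \<in> E" | j where "j \<in> J" "l \<in> I j" by blast
    then show "l \<in> points_with_age Q N"
    proof cases
      case 2
      then have j: "1 \<le> j" "j \<le> M"
        using J_sub by auto
      have "int_age (l / N) = int_age (j / (M + 1))"
        using int_age_cell[of "j - 1" "l / N" "j / (M + 1)"] \<open>l \<in> I j\<close> sample_point_in_cell[OF j]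
        by (simp add: I_iff)
      then have "Q (int_age (l / N))"
        using \<open>j \<in> J\<close> by (simp add: J_def points_with_age_def)
      moreover have "c i * (l / N) \<notin> (\<int>::real set)" if "i \<le> d" for i
        using nonint_cell[of "j - 1" "l / N" i] \<open>l \<in> I j\<close> that by (simp add: I_iff)
      moreover have "0 \<le> l"
      proof -
        have "0 \<le> (j - 1) * N" using j \<open>N > 0\<close> by simp
        then have "0 < M * l" using \<open>l \<in> I j\<close> by (simp add: I_int)
        then show ?thesis using M_pos by (simp add: zero_less_mult_iff)
      qed
      moreover have "l < N"
      proof -
        have "j * N \<le> M * N" using j \<open>N > 0\<close> by simp
        then have "M * l < M * N" using \<open>l \<in> I j\<close> by (simp add: I_int)
        then show ?thesis using M_pos by simp
      qed
      ultimately show ?thesis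
        by (simp add: points_with_age_def nonint_points_def)
    qed (simp add: E_def)
  qed
  have fin_J: "finite J" by (simp add: J_def)
  have fin_E: "finite E" by (simp add: E_def)
  \<comment> \<open>For boundary points the quotient \<open>M * l div N\<close> is exact and so
    determines \<open>l\<close>; it takes at most \<open>M\<close> values.\<close>
  have "card E \<le> card {0..<M}"
  proof (rule card_inj_on_le)
    show "inj_on (\<lambda>l. M * l div N) E"
    proof (rule inj_onI)
      fix l l' assume "l \<in> E" "l' \<in> E" and eq: "M * l div N = M * l' div N"
      then have "N dvd M * l" "N dvd M * l'" by (auto simp: E_def)
      then have "M * l = M * l'" using eq by (metis dvd_div_mult_self)
      then show "l = l'" using M_pos by simp
    qed
    show "(\<lambda>l. M * l div N) ` E \<subseteq> {0..<M}"
      using cell_index by (auto simp: E_def points_with_age_def nonint_points_def)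
  qed simp
  then have E_card: "card E \<le> M"
    using M_pos by simp
  have "card (points_with_age Q N) = card E + (\<Sum>j\<in>J. card (I j))"
    unfolding dec using E_disj fin_J fin_E fin_I I_disj
    by (subst card_Un_disjoint) (auto simp: card_UN_disjoint)
  then have "real (card (points_with_age Q N)) - card J * (N / M) =
      card E + (\<Sum>j\<in>J. real (card (I j)) - N / M)"
    by (simp add: sum_subtractf)
  moreover have "\<bar>\<Sum>j\<in>J. real (card (I j)) - N / M\<bar> \<le> card J"
    using sum_mono[of J "\<lambda>j. \<bar>real (card (I j)) - N / M\<bar>" "\<lambda>_. 1"] I_card
    by (intro order_trans[OF sum_abs]) simp
  ultimately show ?thesis
    using J_card E_card unfolding J_def by linarith
qed

text \<open>Division by \<open>n\<close> turns the uniform error \<open>2 * M\<close> into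
  \<open>2 * M / n\<close>.\<close>

lemma card_points_with_age_tendsto:
  "(\<lambda>n. card (points_with_age Q (int n)) / n) \<longlonglongrightarrow> card (points_with_age Q (M + 1)) / M"
proof -
  let ?K = "card (points_with_age Q (M + 1)) / M"
  have "(\<lambda>n. card (points_with_age Q (int n)) / n - ?K) \<longlonglongrightarrow> 0"
  proof (rule tendsto_0_le[OF lim_inverse_n])
    show "\<forall>\<^sub>F n in sequentially. norm (card (points_with_age Q (int n)) / n - ?K)
        \<le> norm (inverse (real n)) * (2 * M)"
      using eventually_gt_at_top[of 0]
    proof eventually_elim
      case (elim n)
      have "card (points_with_age Q (int n)) / n - ?K =
          (card (points_with_age Q (int n)) - card (points_with_age Q (M + 1)) * (int n / M)) / n"
        using elim M_pos by (simp add: field_simps)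
      moreover have "\<bar>(card (points_with_age Q (int n)) - card (points_with_age Q (M + 1)) * (int n / M)) / n\<bar>
          \<le> 2 * M / n"
        using card_points_with_age_approx[of "int n" Q] elim
        by (simp add: divide_right_mono abs_divide)
      ultimately show ?case by (simp add: divide_inverse mult_ac)
    qed
  qed
  then show ?thesis
    by (simp add: LIM_zero_iff)
qed

end

section \<open>The group of a one-row simplex\<close>

text \<open>Applying the transpose of \<open>A\<close> undoes that of its inverse, so membership is
  tested without computing the inverse. The nonzero determinant makes \<open>mat_inverse\<close>
  return a genuine inverse.\<close>

lemma transpose_mat_inverse_image_iff:
  fixes A :: "real mat"
  assumes A: "A \<in> carrier_mat n n" and det: "det A \<noteq> 0"
    and V: "V \<subseteq> carrier_vec n"
  shows "x \<in> (\<lambda>u. transpose_mat (the (mat_inverse A)) *\<^sub>v u) ` V \<longleftrightarrow>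
    x \<in> carrier_vec n \<and> transpose_mat A *\<^sub>v x \<in> V"
proof -
  have "A \<in> Units (ring_mat TYPE(real) n ())"
    using A det by (rule det_non_zero_imp_unit)
  then obtain B where "mat_inverse A = Some B"
    using mat_inverse(1)[OF A, where b = "()"] by (cases "mat_inverse A") auto
  with mat_inverse(2)[OF A this] have AB: "A * B = 1\<^sub>m n" "B * A = 1\<^sub>m n"
    and B: "B \<in> carrier_mat n n" and inv: "the (mat_inverse A) = B"
    by auto
  have tr: "transpose_mat A * transpose_mat B = 1\<^sub>m n" "transpose_mat B * transpose_mat A = 1\<^sub>m n"
    using transpose_mult[OF B A] transpose_mult[OF A B] unfolding AB transpose_one by simp_all
  have carr: "transpose_mat A \<in> carrier_mat n n" "transpose_mat B \<in> carrier_mat n n"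
    using A B by auto
  have 1: "transpose_mat A *\<^sub>v (transpose_mat B *\<^sub>v u) = u" if "u \<in> carrier_vec n" for u
    using that by (simp add: assoc_mult_mat_vec[OF carr that, symmetric] tr)
  have 2: "transpose_mat B *\<^sub>v (transpose_mat A *\<^sub>v u) = u" if "u \<in> carrier_vec n" for u
    using that by (simp add: assoc_mult_mat_vec[OF carr(2,1) that, symmetric] tr)
  show ?thesis
    unfolding inv
  proof
    assume "x \<in> (\<lambda>u. transpose_mat B *\<^sub>v u) ` V"
    then obtain u where u: "u \<in> V" "x = transpose_mat B *\<^sub>v u" by blast
    then have "u \<in> carrier_vec n" using V by blast
    then show "x \<in> carrier_vec n \<and> transpose_mat A *\<^sub>v x \<in> V"
      using u 1 carr by (auto intro!: mult_mat_vec_carrier[of _ n n])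
  next
    assume x: "x \<in> carrier_vec n \<and> transpose_mat A *\<^sub>v x \<in> V"
    then have "x = transpose_mat B *\<^sub>v (transpose_mat A *\<^sub>v x)"
      using 2 by simp
    then show "x \<in> (\<lambda>u. transpose_mat B *\<^sub>v u) ` V"
      using x by blast
  qed
qed

lemma length_one_row_simplex: "d \<ge> 1 \<Longrightarrow> length (one_row_simplex d a N) = d + 1"
  by (simp add: one_row_simplex_def)

lemma vertex_matrix_one_row_simplex:
  assumes "d \<ge> 1" "i \<le> d" "j \<le> d"
  shows "vertex_matrix (one_row_simplex d a N) $$ (i, j) =
    (if j = 0 then 1 else if i = d then of_int (if j < d then a j else N) else of_bool (i = j))"
proof -
  have "vertex_matrix (one_row_simplex d a N) $$ (i, j) = vCons 1 (one_row_simplex d a N ! i) $ j"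
    using assms by (simp add: vertex_matrix_def mat_of_rows_index length_one_row_simplex)
  moreover have "one_row_simplex d a N ! i =
     (if i = 0 then 0\<^sub>v d else if i = d then vec d (\<lambda>j. of_int (if j < d - 1 then a (j + 1) else N))
      else unit_vec d (i - 1))"
    using assms by (auto simp: one_row_simplex_def nth_append nth_Cons' )
  moreover have "vCons 1 v $ j = (if j = 0 then 1 else v $ (j - 1))" for v :: "real vec"
    by (rule vec_index_vCons)
  ultimately have *: "vertex_matrix (one_row_simplex d a N) $$ (i, j) =
     (if j = 0 then 1 else (if i = 0 then 0\<^sub>v d else if i = d
        then vec d (\<lambda>j. of_int (if j < d - 1 then a (j + 1) else N)) else unit_vec d (i - 1)) $ (j - 1))"
    by (simp only:)
  consider "j = 0" | "j \<noteq> 0" "i = 0" | "j \<noteq> 0" "i = d" | "j \<noteq> 0" "i \<noteq> 0" "i \<noteq> d"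
    by blast
  then show ?thesis
  proof cases
    case 1
    then show ?thesis
      unfolding * by simp
  next
    case 2
    then show ?thesis
      unfolding * using assms by simp
  next
    case 3
    then have "j - 1 < d" "j - 1 < d - 1 \<longleftrightarrow> j < d" "j - 1 + 1 = j"
      using assms by linarith+
    then show ?thesis
      unfolding * using 3 assms by simp
  next
    case 4
    then have "i - 1 < d" "j - 1 < d" "j - 1 = i - 1 \<longleftrightarrow> i = j"
      using assms by linarith+
    then show ?thesis
      unfolding * using 4 by (simp add: index_unit_vec)
  qed
qed

lemma vertex_matrix_carrier:
  "d \<ge> 1 \<Longrightarrow> vertex_matrix (one_row_simplex d a N) \<in> carrier_mat (d + 1) (d + 1)"
  by (simp add: vertex_matrix_def length_one_row_simplex mat_of_rows_def)

text \<open>In this vertex order the matrix is lower triangular, with diagonal entries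
  \<open>1\<close> and finally \<open>N\<close>.\<close>

lemma det_vertex_matrix_one_row_simplex:
  assumes "d \<ge> 1" "N > 0"
  shows "det (vertex_matrix (one_row_simplex d a N)) \<noteq> 0"
proof -
  let ?A = "vertex_matrix (one_row_simplex d a N)"
  have "det ?A = prod_list (diag_mat ?A)"
    by (rule det_lower_triangular[OF _ vertex_matrix_carrier[OF \<open>d \<ge> 1\<close>]])
      (use assms in \<open>auto simp: vertex_matrix_one_row_simplex\<close>)
  moreover have "?A $$ (i, i) \<noteq> 0" if "i < d + 1" for i
    using assms that by (auto simp: vertex_matrix_one_row_simplex)
  then have "0 \<notin> set (diag_mat ?A)"
    using vertex_matrix_carrier[OF \<open>d \<ge> 1\<close>, of a N] by (auto simp: diag_mat_def)
  ultimately show ?thesis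
    by (simp add: prod_list_zero_iff)
qed

text \<open>These are \<open>N\<close> times the coordinates of the standard generator of the
  group.\<close>

definition weights :: "nat \<Rightarrow> (nat \<Rightarrow> int) \<Rightarrow> nat \<Rightarrow> int" where
  "weights d a i = (if i = 0 then -1 + (\<Sum>i=1..d - 1. a i) else if i = d then 1 else - a i)"

lemma sum_atMost_split_ends:
  fixes f :: "nat \<Rightarrow> 'a::comm_monoid_add"
  assumes "d \<ge> 1"
  shows "(\<Sum>i\<le>d. f i) = f 0 + (\<Sum>i=1..d - 1. f i) + f d"
proof -
  have "{..d} = insert 0 (insert d {1..d - 1})"
    using assms by auto
  then show ?thesis
    using assms by (simp add: ac_simps)
qed

lemma sum_weights_eq_0:
  assumes "d \<ge> 1"
  shows "(\<Sum>i\<le>d. weights d a i) = 0"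
proof -
  have "(\<Sum>i=1..d - 1. weights d a i) = (\<Sum>i=1..d - 1. - a i)"
    using assms by (intro sum.cong) (auto simp: weights_def)
  then show ?thesis
    using assms by (simp add: sum_atMost_split_ends weights_def sum_negf)
qed

lemma transpose_vertex_matrix_mult:
  assumes d: "d \<ge> 1" and x: "x \<in> carrier_vec (d + 1)" and j: "j \<le> d"
  shows "(transpose_mat (vertex_matrix (one_row_simplex d a N)) *\<^sub>v x) $ j =
    (if j = 0 then (\<Sum>i\<le>d. x $ i) else if j < d then x $ j + a j * x $ d else N * x $ d)"
proof -
  let ?A = "vertex_matrix (one_row_simplex d a N)"
  have A: "?A \<in> carrier_mat (d + 1) (d + 1)"
    using d by (rule vertex_matrix_carrier)
  have "(transpose_mat ?A *\<^sub>v x) $ j = (\<Sum>i\<le>d. ?A $$ (i, j) * x $ i)"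
    using A x j by (simp add: scalar_prod_def atLeast0LessThan lessThan_Suc_atMost)
  also have "\<dots> = (\<Sum>i<d. ?A $$ (i, j) * x $ i) + ?A $$ (d, j) * x $ d"
    by (simp add: lessThan_Suc_atMost[symmetric])
  also have "(\<Sum>i<d. ?A $$ (i, j) * x $ i) =
      (\<Sum>i<d. if j = 0 then x $ i else if i = j then x $ i else 0)"
    using d j by (intro sum.cong) (auto simp: vertex_matrix_one_row_simplex)
  finally show ?thesis
    using d j by (auto simp: vertex_matrix_one_row_simplex lessThan_Suc_atMost[symmetric] of_bool_def)
qed

text \<open>The integrality conditions are solved from the last column backwards: it yields
  \<open>l\<close>, the middle columns fix the coordinates \<open>1\<close> to \<open>d - 1\<close>
  modulo integers, and the column of ones fixes coordinate \<open>0\<close>.\<close>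

lemma simplex_lattice_iff:
  assumes d: "d \<ge> 1" and N: "N > 0"
  shows "x \<in> simplex_lattice (one_row_simplex d a N) \<longleftrightarrow>
    x \<in> carrier_vec (d + 1) \<and> (\<exists>l::int. \<forall>i\<le>d. x $ i - weights d a i * (l / N) \<in> \<int>)"
    (is "?L \<longleftrightarrow> ?R")
proof -
  let ?A = "vertex_matrix (one_row_simplex d a N)"
  have "?L \<longleftrightarrow> x \<in> carrier_vec (d + 1) \<and> transpose_mat ?A *\<^sub>v x \<in> int_vecs (d + 1)"
    unfolding simplex_lattice_def length_one_row_simplex[OF d]
    by (rule transpose_mat_inverse_image_iff[OF vertex_matrix_carrier[OF d]
          det_vertex_matrix_one_row_simplex[OF d N]]) (auto simp: int_vecs_def)
  also have "\<dots> \<longleftrightarrow> x \<in> carrier_vec (d + 1) \<and>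
      (\<forall>j\<le>d. (if j = 0 then (\<Sum>i\<le>d. x $ i) else if j < d then x $ j + a j * x $ d
               else N * x $ d) \<in> \<int>)"
  proof (intro conj_cong refl)
    assume x: "x \<in> carrier_vec (d + 1)"
    have "transpose_mat ?A *\<^sub>v x \<in> carrier_vec (d + 1)"
      using vertex_matrix_carrier[OF d, of a N] by (intro mult_mat_vec_carrier[OF _ x]) simp
    then show "transpose_mat ?A *\<^sub>v x \<in> int_vecs (d + 1) \<longleftrightarrow>
        (\<forall>j\<le>d. (if j = 0 then (\<Sum>i\<le>d. x $ i) else if j < d then x $ j + a j * x $ d
                 else N * x $ d) \<in> \<int>)"
      by (simp add: int_vecs_def less_Suc_eq_le transpose_vertex_matrix_mult[OF d x] del: index_mult_mat_vec)
  qed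
  also have "\<dots> \<longleftrightarrow> ?R"
  proof (intro conj_cong refl iffI)
    assume *: "\<forall>j\<le>d. (if j = 0 then (\<Sum>i\<le>d. x $ i) else if j < d then x $ j + a j * x $ d
               else N * x $ d) \<in> \<int>"
    from *[rule_format, of d] obtain l :: int where l: "N * x $ d = l"
      using d by (auto elim: Ints_cases)
    then have xd: "x $ d = l / N"
      using N by (simp add: field_simps)
    have mid: "x $ i + a i * (l / N) \<in> \<int>" if "1 \<le> i" "i < d" for i
      using *[rule_format, of i] that xd by auto
    have "x $ i - weights d a i * (l / N) \<in> \<int>" if "i \<le> d" for i
    proof -
      consider "i = 0" | "1 \<le> i" "i < d" | "i = d"
        using \<open>i \<le> d\<close> by fastforce
      then show ?thesis
      proof cases
        case 1
        have "(\<Sum>i\<le>d. x $ i) \<in> \<int>"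
          using *[rule_format, of 0] by simp
        moreover have "(\<Sum>i=1..d - 1. x $ i + a i * (l / N)) \<in> \<int>"
          using mid by (intro Ints_sum) auto
        \<comment> \<open>Removing the middle terms leaves \<open>x $ 0 + x $ d\<close> minus all
          \<open>a i * (l / N)\<close>, where \<open>x $ d = l / N\<close>.\<close>
        ultimately have "(\<Sum>i\<le>d. x $ i) - (\<Sum>i=1..d - 1. x $ i + a i * (l / N)) \<in> \<int>"
          by (rule Ints_diff)
        also have "(\<Sum>i\<le>d. x $ i) - (\<Sum>i=1..d - 1. x $ i + a i * (l / N)) =
            x $ 0 - weights d a 0 * (l / N)"
          using d xd by (simp add: sum_atMost_split_ends weights_def sum.distrib sum_distrib_right
              sum_divide_distrib left_diff_distrib diff_divide_distrib)
        finally show ?thesis using 1 by simp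
      next
        case 2
        then show ?thesis using mid[of i] by (simp add: weights_def)
      next
        case 3
        then show ?thesis using d xd by (simp add: weights_def)
      qed
    qed
    then show "\<exists>l::int. \<forall>i\<le>d. x $ i - weights d a i * (l / N) \<in> \<int>"
      by blast
  next
    assume "\<exists>l::int. \<forall>i\<le>d. x $ i - weights d a i * (l / N) \<in> \<int>"
    then obtain l :: int where l: "\<And>i. i \<le> d \<Longrightarrow> x $ i - weights d a i * (l / N) \<in> \<int>"
      by blast
    have xd: "x $ d - l / N \<in> \<int>"
      using l[of d] d by (simp add: weights_def)
    \<comment> \<open>The weights sum to zero, so the multiples of \<open>l / N\<close>
      cancel.\<close>
    have "(\<Sum>i\<le>d. x $ i - weights d a i * (l / N)) \<in> \<int>"
      using l by (intro Ints_sum) auto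
    also have "(\<Sum>i\<le>d. x $ i - weights d a i * (l / N)) =
        (\<Sum>i\<le>d. x $ i) - of_int (\<Sum>i\<le>d. weights d a i) * (l / N)"
      by (simp add: sum_subtractf sum_distrib_right sum_divide_distrib)
    finally have "(\<Sum>i\<le>d. x $ i) \<in> \<int>"
      by (simp add: sum_weights_eq_0[OF d])
    moreover have "x $ j + a j * x $ d \<in> \<int>" if "j \<noteq> 0" "j < d" for j
    proof -
      have "x $ j + a j * (l / N) \<in> \<int>"
        using l[of j] that by (simp add: weights_def)
      then have "(x $ j + a j * (l / N)) + of_int (a j) * (x $ d - l / N) \<in> \<int>"
        using xd by (rule Ints_add[OF _ Ints_mult[OF Ints_of_int]])
      then show ?thesis by (simp add: algebra_simps)
    qed
    moreover have "N * x $ d \<in> \<int>"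
    proof -
      have "of_int N * (x $ d - l / N) + of_int l \<in> \<int>"
        using xd by (intro Ints_add Ints_mult) auto
      then show ?thesis using N by (simp add: algebra_simps)
    qed
    ultimately show "\<forall>j\<le>d. (if j = 0 then (\<Sum>i\<le>d. x $ i) else if j < d then x $ j + a j * x $ d
               else N * x $ d) \<in> \<int>"
      by simp
  qed
  finally show ?thesis .
qed

section \<open>Cosets, their representatives and their enumeration\<close>

text \<open>Two points of the half-open unit cube that differ by an integer vector coincide, so the
  definite description has a unique solution.\<close>

lemma class_rep_eqI:
  assumes p: "p \<in> carrier_vec n" and bounds: "\<And>i. i < n \<Longrightarrow> 0 \<le> p $ i \<and> p $ i < 1"
    and C: "C = (\<lambda>u. p + u) ` int_vecs n"
  shows "class_rep C = p"
  unfolding class_rep_def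
proof (rule the_equality)
  have "0\<^sub>v n \<in> int_vecs n"
    by (simp add: int_vecs_def)
  then have "p \<in> C"
    unfolding C using p by (metis image_eqI right_zero_vec)
  then show "p \<in> C \<and> (\<forall>i<dim_vec p. 0 \<le> p $ i \<and> p $ i < 1)"
    using p bounds by auto
next
  fix x assume x: "x \<in> C \<and> (\<forall>i<dim_vec x. 0 \<le> x $ i \<and> x $ i < 1)"
  then obtain u where u: "u \<in> int_vecs n" "x = p + u"
    by (auto simp: C)
  then have uc: "u \<in> carrier_vec n"
    by (simp add: int_vecs_def)
  show "x = p"
  proof (rule eq_vecI)
    show "dim_vec x = dim_vec p"
      using u uc p by simp
    fix i assume "i < dim_vec p"
    then have i: "i < n" using p by simp
    have "u $ i \<in> \<int>" using u i by (simp add: int_vecs_def)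
    then obtain m :: int where m: "u $ i = m" by (elim Ints_cases)
    have "x $ i = p $ i + m" using u uc p i m by simp
    moreover have "0 \<le> x $ i" "x $ i < 1"
      using x u uc p i by auto
    ultimately have "m = 0"
      using bounds[OF i] by linarith
    then show "x $ i = p $ i" using \<open>x $ i = p $ i + m\<close> by simp
  qed
qed

definition lattice_point :: "nat \<Rightarrow> (nat \<Rightarrow> int) \<Rightarrow> int \<Rightarrow> int \<Rightarrow> real vec" where
  "lattice_point d a N l = vec (d + 1) (\<lambda>i. frac (weights d a i * (l / N)))"

definition lattice_class :: "nat \<Rightarrow> (nat \<Rightarrow> int) \<Rightarrow> int \<Rightarrow> int \<Rightarrow> real vec set" where
  "lattice_class d a N l = (\<lambda>u. lattice_point d a N l + u) ` int_vecs (d + 1)"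

lemma class_rep_lattice_class: "class_rep (lattice_class d a N l) = lattice_point d a N l"
  by (rule class_rep_eqI[OF _ _ lattice_class_def]) (auto simp: lattice_point_def frac_lt_1)

lemma translate_int_vecs_eqI:
  assumes x: "x \<in> carrier_vec n" and y: "y \<in> carrier_vec n"
    and diff: "\<And>i. i < n \<Longrightarrow> x $ i - y $ i \<in> \<int>"
  shows "(\<lambda>u. x + u) ` int_vecs n = (\<lambda>u. y + u) ` int_vecs n"
proof -
  have sub: "(\<lambda>u. x + u) ` int_vecs n \<subseteq> (\<lambda>u. y + u) ` int_vecs n"
    if x: "x \<in> carrier_vec n" and y: "y \<in> carrier_vec n"
      and diff: "\<And>i. i < n \<Longrightarrow> x $ i - y $ i \<in> \<int>" for x y :: "real vec"
  proof (rule image_subsetI)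
    fix u assume u: "u \<in> int_vecs n"
    then have uc: "u \<in> carrier_vec n" by (simp add: int_vecs_def)
    have "x + u = y + (x - y + u)"
      using x y uc by (intro eq_vecI) auto
    moreover have "x - y + u \<in> int_vecs n"
      using x y u diff by (auto simp: int_vecs_def)
    ultimately show "x + u \<in> (\<lambda>u. y + u) ` int_vecs n"
      by (metis image_eqI)
  qed
  show ?thesis
  proof (rule equalityI)
    show "(\<lambda>u. y + u) ` int_vecs n \<subseteq> (\<lambda>u. x + u) ` int_vecs n"
      using sub[OF y x] diff Ints_minus minus_diff_eq by metis
  qed (rule sub[OF x y diff])
qed

lemma lattice_class_eq:
  assumes "x \<in> carrier_vec (d + 1)" and "\<And>i. i \<le> d \<Longrightarrow> x $ i - weights d a i * (l / N) \<in> \<int>"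
  shows "(\<lambda>u. x + u) ` int_vecs (d + 1) = lattice_class d a N l"
  unfolding lattice_class_def
proof (rule translate_int_vecs_eqI[OF assms(1)])
  fix i assume i: "i < d + 1"
  have "(x $ i - weights d a i * (l / N)) + of_int \<lfloor>weights d a i * (l / N :: real)\<rfloor> \<in> \<int>"
    using assms(2)[of i] i by (intro Ints_add) auto
  moreover have "(x $ i - weights d a i * (l / N)) + of_int \<lfloor>weights d a i * (l / N :: real)\<rfloor> =
      x $ i - lattice_point d a N l $ i"
    using i by (simp add: lattice_point_def frac_def)
  ultimately show "x $ i - lattice_point d a N l $ i \<in> \<int>"
    by (simp only:)
qed (simp add: lattice_point_def)

lemma simplex_group_one_row:
  assumes d: "d \<ge> 1" and N: "N > 0"
  shows "simplex_group (one_row_simplex d a N) = lattice_class d a N ` {0..<N}"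
proof
  show "simplex_group (one_row_simplex d a N) \<subseteq> lattice_class d a N ` {0..<N}"
  proof
    fix C assume "C \<in> simplex_group (one_row_simplex d a N)"
    then obtain x where x: "x \<in> simplex_lattice (one_row_simplex d a N)"
      and C: "C = (\<lambda>u. x + u) ` int_vecs (d + 1)"
      by (auto simp: simplex_group_def length_one_row_simplex[OF d])
    from x obtain l :: int where xc: "x \<in> carrier_vec (d + 1)"
      and l: "\<And>i. i \<le> d \<Longrightarrow> x $ i - weights d a i * (l / N) \<in> \<int>"
      unfolding simplex_lattice_iff[OF d N] by blast
    \<comment> \<open>Replacing \<open>l\<close> by \<open>l mod N\<close> changes each coordinate
      by \<open>l div N\<close> times an integer weight.\<close>
    have "x $ i - weights d a i * ((l mod N) / N) \<in> \<int>" if "i \<le> d" for i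
    proof -
      have mod_eq: "real_of_int (l mod N) = l - N * (l div N)"
        by (metis minus_mult_div_eq_mod of_int_diff of_int_mult)
      have "l / N = (l div N) + (l mod N) / (N::real)"
        using N by (simp add: mod_eq diff_divide_distrib)
      then have "x $ i - weights d a i * ((l mod N) / N) =
          (x $ i - weights d a i * (l / N)) + of_int (weights d a i * (l div N))"
        by (simp add: algebra_simps)
      then show ?thesis using l[OF that] by (simp only:) (intro Ints_add; simp)
    qed
    then have "C = lattice_class d a N (l mod N)"
      unfolding C by (rule lattice_class_eq[OF xc])
    then show "C \<in> lattice_class d a N ` {0..<N}"
      using N by simp
  qed
  show "lattice_class d a N ` {0..<N} \<subseteq> simplex_group (one_row_simplex d a N)"
  proof (rule image_subsetI)
    fix l
    have "lattice_point d a N l $ i - weights d a i * (l / N) \<in> \<int>" if "i \<le> d" for i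
      using that by (simp add: lattice_point_def frac_def)
    then have "lattice_point d a N l \<in> simplex_lattice (one_row_simplex d a N)"
      unfolding simplex_lattice_iff[OF d N] by (auto simp: lattice_point_def)
    then show "lattice_class d a N l \<in> simplex_group (one_row_simplex d a N)"
      by (auto simp: simplex_group_def lattice_class_def length_one_row_simplex[OF d])
  qed
qed

text \<open>The weight at index \<open>d\<close> is \<open>1\<close>, so the last coordinate of the
  representative is \<open>l / N\<close> itself.\<close>

lemma inj_on_lattice_class:
  assumes d: "d \<ge> 1" and N: "N > 0"
  shows "inj_on (lattice_class d a N) {0..<N}"
proof (rule inj_onI)
  fix l l' assume l: "l \<in> {0..<N}" and l': "l' \<in> {0..<N}"
    and "lattice_class d a N l = lattice_class d a N l'"
  then have "lattice_point d a N l $ d = lattice_point d a N l' $ d"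
    using class_rep_lattice_class by metis
  then have "frac (l / N) = frac (l' / N :: real)"
    using d by (simp add: lattice_point_def weights_def)
  moreover have "frac (k / N :: real) = k / N" if "k \<in> {0..<N}" for k :: int
    using that N by (simp add: frac_eq)
  ultimately show "l = l'"
    using l l' N by simp
qed

text \<open>Fractional parts are below 1 and are positive exactly at nonintegers, so the open-cube
  condition becomes nonintegrality. Injectivity allows summing over numerators.\<close>

lemma local_hstar_one_row:
  assumes d: "d \<ge> 1" and N: "N > 0"
  shows "local_hstar (one_row_simplex d a N) =
    (\<Sum>l \<in> {l::int. l \<in> {0..<N} \<and> (\<forall>i\<le>d. weights d a i * (l / N) \<notin> (\<int> :: real set))}.
       monom 1 (nat \<lfloor>\<Sum>i\<le>d. frac (weights d a i * (l / N :: real))\<rfloor>))"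
proof -
  let ?G = "{l \<in> {0..<N}. \<forall>i\<le>d. weights d a i * (l / N) \<notin> (\<int> :: real set)}"
  have "{C \<in> simplex_group (one_row_simplex d a N). \<forall>i<length (one_row_simplex d a N).
      0 < class_rep C $ i \<and> class_rep C $ i < 1} = lattice_class d a N ` ?G"
    unfolding simplex_group_one_row[OF d N] length_one_row_simplex[OF d]
    by (auto simp: class_rep_lattice_class lattice_point_def frac_lt_1 less_Suc_eq_le frac_gt_0_iff)
  moreover have "inj_on (lattice_class d a N) ?G"
    by (rule inj_on_subset[OF inj_on_lattice_class[OF d N]]) auto
  moreover have "age (lattice_point d a N l) = (\<Sum>i\<le>d. frac (weights d a i * (l / N :: real)))" for l
    by (simp add: age_def lattice_point_def lessThan_Suc_atMost del: sum.lessThan_Suc)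
  ultimately show ?thesis
    unfolding local_hstar_def by (simp only: sum.reindex o_def class_rep_lattice_class)
qed

section \<open>Limits of strictly unimodal polynomials\<close>

lemma strictly_decreasing_chain:
  fixes f :: "nat \<Rightarrow> real"
  assumes "\<And>i. m \<le> i \<Longrightarrow> i < n \<Longrightarrow> f (i + 1) < f i" and "m \<le> i" "i < j" "j \<le> n"
  shows "f j < f i"
  using \<open>i < j\<close> \<open>j \<le> n\<close>
proof (induction j)
  case (Suc j)
  then have "f (j + 1) < f j"
    using assms(1)[of j] \<open>m \<le> i\<close> by simp
  then show ?case
    using Suc by (cases "i = j") auto
qed simp

text \<open>If the mirror image \<open>d + 1 - m\<close> of \<open>m\<close> lay beyond
  \<open>m + 1\<close>, strict decrease would contradict symmetry. If the mirror image
  \<open>d - m\<close> of \<open>m + 1\<close> lay before \<open>m\<close>, strict increase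
  would.\<close>

lemma strictly_unimodal_symmetric_plateau:
  fixes p :: "real poly"
  assumes sym: "\<And>i. i \<in> {1..d} \<Longrightarrow> coeff p (d + 1 - i) = coeff p i"
    and m: "1 \<le> m" "m < d"
    and up: "\<And>i. 1 \<le> i \<Longrightarrow> i < m \<Longrightarrow> coeff p i < coeff p (i + 1)"
    and down: "\<And>i. m < i \<Longrightarrow> i < d \<Longrightarrow> coeff p i > coeff p (i + 1)"
    and eq: "coeff p m = coeff p (m + 1)"
  shows "d = 2 * m"
proof (rule antisym; rule ccontr)
  assume "\<not> d \<le> 2 * m"
  then have "coeff p (d + 1 - m) < coeff p (m + 1)"
    using m down strictly_decreasing_chain[of "m + 1" d "coeff p" "m + 1" "d + 1 - m"] by simp
  then show False
    using sym[of m] m eq by simp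
next
  assume "\<not> 2 * m \<le> d"
  then have "- coeff p m < - coeff p (d - m)"
    using m up strictly_decreasing_chain[of 1 m "\<lambda>i. - coeff p i" "d - m" m] by simp
  then show False
    using sym[of "m + 1"] m eq by simp
qed

lemma strictly_unimodal_eventually:
  fixes p :: "real poly" and q :: "nat \<Rightarrow> real poly" and T :: "nat \<Rightarrow> real"
  assumes lim: "\<And>i. (\<lambda>k. coeff (q k) i / T k) \<longlonglongrightarrow> coeff p i / t"
    and t: "t > 0" and T: "\<forall>\<^sub>F k in sequentially. T k \<ge> 0"
    and sym_p: "\<And>i. i \<in> {1..d} \<Longrightarrow> coeff p (d + 1 - i) = coeff p i"
    and sym_q: "\<forall>\<^sub>F k in sequentially. \<forall>i\<in>{1..d}. coeff (q k) (d + 1 - i) = coeff (q k) i"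
    and uni: "strictly_unimodal d p"
  shows "\<forall>\<^sub>F k in sequentially. strictly_unimodal d (q k)"
proof -
  have less: "\<forall>\<^sub>F k in sequentially. coeff (q k) i < coeff (q k) j" if "coeff p i < coeff p j" for i j
  proof -
    have "(\<lambda>k. coeff (q k) j / T k - coeff (q k) i / T k) \<longlonglongrightarrow> coeff p j / t - coeff p i / t"
      by (intro tendsto_diff lim)
    moreover have "coeff p j / t - coeff p i / t > 0"
      using that t by (simp add: divide_strict_right_mono)
    ultimately have "\<forall>\<^sub>F k in sequentially. 0 < coeff (q k) j / T k - coeff (q k) i / T k"
      by (rule order_tendstoD(1))
    then show ?thesis
      using T
    proof eventually_elim
      case (elim k)
      then have "0 < (coeff (q k) j - coeff (q k) i) / T k"
        by (simp add: diff_divide_distrib)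
      \<comment> \<open>Division by zero yields \<open>0\<close>, so a positive quotient excludes
        \<open>T k = 0\<close> and leaves \<open>T k\<close> positive.\<close>
      then show ?case
        using elim(2) by (simp add: zero_less_divide_iff)
    qed
  qed
  obtain m where m: "m \<in> {1..d}"
    and up: "\<And>i. 1 \<le> i \<Longrightarrow> i < m \<Longrightarrow> coeff p i < coeff p (i + 1)"
    and peak: "m < d \<Longrightarrow> coeff p m \<ge> coeff p (m + 1)"
    and down: "\<And>i. m < i \<Longrightarrow> i < d \<Longrightarrow> coeff p i > coeff p (i + 1)"
    using uni unfolding strictly_unimodal_def by blast
  have "\<forall>\<^sub>F k in sequentially. \<forall>i\<in>{1..<m}. coeff (q k) i < coeff (q k) (i + 1)"
    using up less by (intro eventually_ball_finite) auto
  moreover have "\<forall>\<^sub>F k in sequentially. \<forall>i\<in>{m<..<d}. coeff (q k) i > coeff (q k) (i + 1)"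
    using down less by (intro eventually_ball_finite) auto
  moreover have "\<forall>\<^sub>F k in sequentially. m < d \<longrightarrow> coeff (q k) m \<ge> coeff (q k) (m + 1)"
  proof (cases "m < d \<and> coeff p m = coeff p (m + 1)")
    case True
    \<comment> \<open>Equality in the limit says nothing about \<open>q k\<close>. But the plateau
      is central, so \<open>m\<close> and \<open>m + 1\<close> are mirror images and the symmetry of
      \<open>q k\<close> applies.\<close>
    then have "d = 2 * m"
      using strictly_unimodal_symmetric_plateau[OF sym_p _ _ up down] m by simp
    show ?thesis
      using sym_q
    proof eventually_elim
      case (elim k)
      then show ?case
        using m \<open>d = 2 * m\<close> by (auto dest!: bspec[of _ _ m])
    qed
  next
    case False
    show ?thesis
    proof (cases "m < d")
      case True
      then have "coeff p (m + 1) < coeff p m"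
        using False peak by simp
      from less[OF this] show ?thesis
        by eventually_elim simp
    qed simp
  qed
  ultimately show ?thesis
  proof eventually_elim
    case (elim k)
    then show ?case
      unfolding strictly_unimodal_def using m by (intro bexI[of _ m]) auto
  qed
qed

section \<open>The local h*-polynomial\<close>

lemma
  assumes "zero_sum_weights d (weights d a) M" and d: "d \<ge> 1" and N: "N > 0"
  shows coeff_local_hstar_one_row: "coeff (local_hstar (one_row_simplex d a N)) i =
      card (zero_sum_weights.points_with_age d (weights d a) (\<lambda>n. n = int i) N)" (is ?coeff)
    and poly_local_hstar_one_row: "poly (local_hstar (one_row_simplex d a N)) 1 =
      card (zero_sum_weights.points_with_age d (weights d a) (\<lambda>_. True) N)" (is ?poly)
proof -
  interpret zero_sum_weights d "weights d a" M by fact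
  have eq: "local_hstar (one_row_simplex d a N) =
      (\<Sum>l\<in>nonint_points N. monom 1 (nat (int_age (l / N))))"
    unfolding local_hstar_one_row[OF d N] nonint_points_def sum_frac_eq_int_age floor_of_int ..
  \<comment> \<open>Ages are nonnegative, so \<open>nat\<close> merges no distinct ages.\<close>
  have "nat (int_age t) = i \<longleftrightarrow> int_age t = int i" for t
    using int_age_nonneg[of t] by auto
  then have "coeff (local_hstar (one_row_simplex d a N)) i =
      (\<Sum>l\<in>nonint_points N. if int_age (l / N) = int i then 1 else 0)"
    unfolding eq by (simp add: coeff_sum)
  also have "\<dots> = card (points_with_age (\<lambda>n. n = int i) N)"
    unfolding points_with_age_def by (subst sum.inter_filter[symmetric]) simp_all
  finally show ?coeff .
  show ?poly
    unfolding eq points_with_age_def by (simp add: poly_sum poly_monom)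
qed

theorem theorem5p3:
  fixes d :: nat and a :: "nat \<Rightarrow> int" and M r :: int and B :: "int \<Rightarrow> real poly"
  assumes d: "d \<ge> 1"
    and a: "\<And>i. i \<in> {1..d - 1} \<Longrightarrow> a i \<ge> 1"
    and M: "M = Lcm (insert (-1 + (\<Sum>i=1..d - 1. a i)) (a ` {1..d - 1}))"
    and r: "0 \<le> r" "r \<le> M - 1"
    and B: "\<And>N. B N = local_hstar (one_row_simplex d a N)"
  shows "(\<forall>i. (\<lambda>k::nat. coeff (B (int k * M + r)) i / poly (B (int k * M + r)) 1)
             \<longlonglongrightarrow> coeff (B (M + 1)) i / poly (B (M + 1)) 1) \<and>
         (strictly_unimodal d (B (M + 1)) \<longrightarrow>
           (\<forall>\<^sub>F k::nat in sequentially. strictly_unimodal d (B (int k * M + r))))"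
proof -
  \<comment> \<open>The lcm is \<open>0\<close> when the \<open>a i\<close> add up to
    \<open>1\<close>; the range of \<open>r\<close> excludes this.\<close>
  have M_pos: "M > 0"
    using r by linarith
  have weights: "zero_sum_weights d (weights d a) M"
  proof
    show "weights d a i dvd M" if "i \<le> d" for i
    proof -
      consider "i = 0" | "i \<in> {1..d - 1}" "i \<noteq> d" | "i = d" "i \<noteq> 0"
        using \<open>i \<le> d\<close> by fastforce
      then show ?thesis
        by cases (auto simp: M weights_def intro!: dvd_Lcm)
    qed
  qed (use sum_weights_eq_0[OF d] M_pos in auto)
  interpret zero_sum_weights d "weights d a" M by fact
  have coeff_B: "coeff (B N) i = card (points_with_age (\<lambda>n. n = int i) N)" if "N > 0" for N i
    unfolding B by (rule coeff_local_hstar_one_row[OF weights d that])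
  have poly_B: "poly (B N) 1 = card (points_with_age (\<lambda>_. True) N)" if "N > 0" for N
    unfolding B by (rule poly_local_hstar_one_row[OF weights d that])
  have "points_with_age (\<lambda>_. True) (M + 1) = {1..M}"
    unfolding points_with_age_def nonint_points_Suc by auto
  then have card_Suc: "card (points_with_age (\<lambda>_. True) (M + 1)) = nat M"
    by simp
  then have poly_B_Suc: "poly (B (M + 1)) 1 = M"
    using M_pos by (simp add: poly_B)
  \<comment> \<open>For \<open>k = 0\<close> and \<open>r = 0\<close> the volume is
    \<open>0\<close>, so the counting formulas are invoked only eventually.\<close>
  have k_pos: "\<forall>\<^sub>F k in sequentially. int k * M + r > 0"
    using eventually_gt_at_top[of 0] by eventually_elim (use M_pos r in \<open>simp add: add_pos_nonneg\<close>)
  have "filterlim (\<lambda>k. nat (int k * M + r)) at_top sequentially"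
  proof (rule filterlim_at_top_mono[OF filterlim_ident])
    show "\<forall>\<^sub>F k in sequentially. k \<le> nat (int k * M + r)"
    proof (rule always_eventually, rule allI)
      fix k
      have "int k * 1 \<le> int k * M"
        using M_pos by (intro mult_left_mono) auto
      then show "k \<le> nat (int k * M + r)"
        using r by linarith
    qed
  qed
  note subseq = filterlim_compose[OF card_points_with_age_tendsto this]
  have lim: "(\<lambda>k. coeff (B (int k * M + r)) i / poly (B (int k * M + r)) 1)
      \<longlonglongrightarrow> coeff (B (M + 1)) i / poly (B (M + 1)) 1" for i
  proof -
    let ?n = "\<lambda>k. nat (int k * M + r)"
    \<comment> \<open>Dividing both counts by the volume makes each converge. The denominator tends
      to \<open>M / M\<close>, which is nonzero.\<close>
    have "(\<lambda>k. (card (points_with_age (\<lambda>n. n = int i) (int (?n k))) / ?n k) /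
            (card (points_with_age (\<lambda>_. True) (int (?n k))) / ?n k))
        \<longlonglongrightarrow> (card (points_with_age (\<lambda>n. n = int i) (M + 1)) / M) /
            (card (points_with_age (\<lambda>_. True) (M + 1)) / M)"
      by (rule tendsto_divide[OF subseq subseq])
        (use M_pos card_Suc in simp)
    also have "(card (points_with_age (\<lambda>n. n = int i) (M + 1)) / M) /
            (card (points_with_age (\<lambda>_. True) (M + 1)) / M) = coeff (B (M + 1)) i / poly (B (M + 1)) 1"
      using M_pos by (simp add: coeff_B poly_B)
    finally show ?thesis
    proof (rule Lim_transform_eventually)
      show "\<forall>\<^sub>F k in sequentially. (card (points_with_age (\<lambda>n. n = int i) (int (?n k))) / ?n k) /
            (card (points_with_age (\<lambda>_. True) (int (?n k))) / ?n k) =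
          coeff (B (int k * M + r)) i / poly (B (int k * M + r)) 1"
        using k_pos
      proof eventually_elim
        case (elim k)
        then have "real (?n k) \<noteq> 0" "int (?n k) = int k * M + r"
          by linarith+
        then show ?case
          using elim coeff_B[OF elim, of i] poly_B[OF elim] by simp
      qed
    qed
  qed
  have sym: "coeff (B N) (d + 1 - i) = coeff (B N) i" if "N > 0" "i \<in> {1..d}" for N i
    using card_points_with_age_symmetric[OF that(1), of "int i"] that
    by (simp add: coeff_B of_nat_diff add.commute)
  show ?thesis
  proof (intro conjI allI impI)
    assume uni: "strictly_unimodal d (B (M + 1))"
    show "\<forall>\<^sub>F k in sequentially. strictly_unimodal d (B (int k * M + r))"
    proof (rule strictly_unimodal_eventually[OF lim _ _ _ _ uni])
      show "poly (B (M + 1)) 1 > 0"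
        using M_pos by (simp add: poly_B_Suc)
      show "\<forall>\<^sub>F k in sequentially. poly (B (int k * M + r)) 1 \<ge> 0"
        using k_pos by eventually_elim (simp add: poly_B)
      show "coeff (B (M + 1)) (d + 1 - i) = coeff (B (M + 1)) i" if "i \<in> {1..d}" for i
        using M_pos that by (intro sym) auto
      show "\<forall>\<^sub>F k in sequentially. \<forall>i\<in>{1..d}.
          coeff (B (int k * M + r)) (d + 1 - i) = coeff (B (int k * M + r)) i"
        using k_pos by eventually_elim (use sym in blast)
    qed
  qed (rule lim)
qed

end
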